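(* Consider the plant $x_{k+1}=A_px_k+B_pu_k$, $y_k=C_px_k$ with $x_k\in\mathbb{R}^n$, $u_k\in\mathbb{R}^m$, $y_k\in\mathbb{R}^p$, in feedback with the bias-free static implicit controller $$\eta_k=\phi(W\eta_k+Uy_k),\qquad u_k=Ky_k+V\eta_k,\qquad \eta_k\in\mathbb{R}^q.$$ Let $Q\succeq0$, $R\succeq0$, $\beta\in(0,1]$, and $$J_\beta(x_0)=\sum_{k=0}^\infty\beta^k\left(x_k^\top Qx_k+u_k^\top Ru_k\right).$$ Suppose that $\phi$ is componentwise nonexpansive, that $\phi$ satisfies the static sector condition with diagonal matrices $D_0,D_1$, and that $\lambda_{\mathrm{pf}}(|W|)<1$. If there exist $P\succ0$ in $\mathbb{R}^{n\times n}$ and a diagonal $\Lambda\succeq0$ in $\mathbb{R}^{q\times q}$ such that $$\beta F^\top PF-X^\top PX+X^\top QX+G^\top RG+M_\Lambda\preceq0,$$ then every closed-loop trajectory satisfies $J_\beta(x_0)\le x_0^\top Px_0$. Consequently, if $x_0$ is random with second-moment matrix $S_0=\mathbb{E}[x_0x_0^\top]$, then $$\mathbb{E}[J_\beta(x_0)]\le\mathrm{tr}(PS_0).$$ Equivalently, if $x_0$ has mean $\mu_0$ and centered covariance $\Sigma_0$, the bound is $\mathrm{tr}(P\Sigma_0)+\mu_0^\top P\mu_0$.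
   Context: Componentwise nonexpansive: $\phi:\mathbb{R}^q\to\mathbb{R}^q$ acts componentwise, $\phi(r)_i=\phi_i(r_i)$, and $|\phi(r)-\phi(s)|\le|r-s|$ for all $r,s$, with componentwise absolute values and inequalities. Static sector condition: $\phi(0)=0$ and there are diagonal matrices $D_0=\mathrm{diag}(\underline m_i)$, $D_1=\mathrm{diag}(\overline m_i)$ with $0\le\underline m_i\le\overline m_i\le1$ such that $(\phi_i(z_i)-\underline m_iz_i)(\overline m_iz_i-\phi_i(z_i))\ge0$ for all $z_i\in\mathbb{R}$, $i=1,\dots,q$. Notation: $X=[I_n\;\;0]\in\mathbb{R}^{n\times(n+q)}$, $H=[0\;\;I_q]\in\mathbb{R}^{q\times(n+q)}$, $Z=[UC_p\;\;W]$, $F=[A_p+B_pKC_p\;\;B_pV]$, $G=[KC_p\;\;V]$, and $$M_\Lambda=-2Z^\top D_0\Lambda D_1Z+\mathrm{He}\big(H^\top\Lambda(D_0+D_1)Z\big)-2H^\top\Lambda H,$$ where $\mathrm{He}(Y)=Y+Y^\top$. $P\succ0$ means symmetric positive definite; $\preceq,\succeq$ denote the semidefinite order (on symmetric matrices). $|W|$ is the componentwise absolute value and $\lambda_{\mathrm{pf}}(|W|)$ is the Perron--Frobenius eigenvalue (spectral radius) of the nonnegative matrix $|W|$. All matrices are real of compatible dimensions. At each time, $\eta_k$ is the (unique) solution of the algebraic fixed-point equation for the current $y_k$. *)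

theory Defs
  imports "HOL-Probability.Probability"
begin

section \<open>Matrices\<close>

definition diag_matrix :: "real^'a^'a \<Rightarrow> bool" where
  "diag_matrix A \<longleftrightarrow> (\<forall>i j. i \<noteq> j \<longrightarrow> A $ i $ j = 0)"

definition symmetric_matrix :: "real^'a^'a \<Rightarrow> bool" where
  "symmetric_matrix A \<longleftrightarrow> transpose A = A"

definition pos_def :: "real^'a^'a \<Rightarrow> bool" where
  "pos_def A \<longleftrightarrow> symmetric_matrix A \<and> (\<forall>v. v \<noteq> 0 \<longrightarrow> v \<bullet> (A *v v) > 0)"

definition loewner_le :: "real^'a^'a \<Rightarrow> real^'a^'a \<Rightarrow> bool" (infix "\<preceq>\<^sub>L" 50) where
  "A \<preceq>\<^sub>L B \<longleftrightarrow> symmetric_matrix A \<and> symmetric_matrix B \<and>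
     (\<forall>v. v \<bullet> (A *v v) \<le> v \<bullet> (B *v v))"

definition He :: "real^'a^'a \<Rightarrow> real^'a^'a" where
  "He Y = Y + transpose Y"

text \<open>The block row \<open>[A B]\<close>; the columns of \<open>A\<close> are indexed by \<open>Inl\<close>,
  those of \<open>B\<close> by \<open>Inr\<close>.\<close>

definition block_row :: "real^'a^'r \<Rightarrow> real^'b^'r \<Rightarrow> real^('a + 'b)^'r" where
  "block_row A B = (\<chi> i j. case j of Inl k \<Rightarrow> A $ i $ k | Inr l \<Rightarrow> B $ i $ l)"

definition abs_matrix :: "real^'a^'b \<Rightarrow> real^'a^'b" where
  "abs_matrix A = (\<chi> i j. \<bar>A $ i $ j\<bar>)"

text \<open>Complex eigenvalues of a real square matrix. On a nonnegative matrix the spectral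
  radius is itself an eigenvalue, the Perron--Frobenius eigenvalue.\<close>

definition complex_eigenvalues :: "real^'a^'a \<Rightarrow> complex set" where
  "complex_eigenvalues A =
     {c. \<exists>v :: complex^'a. v \<noteq> 0 \<and> (\<chi> i j. complex_of_real (A $ i $ j)) *v v = c *s v}"

definition spectral_radius :: "real^'a^'a \<Rightarrow> real" where
  "spectral_radius A = Max (norm ` complex_eigenvalues A)"

section \<open>Activation functions\<close>

definition acts_componentwise :: "(real^'q \<Rightarrow> real^'q) \<Rightarrow> ('q \<Rightarrow> real \<Rightarrow> real) \<Rightarrow> bool" where
  "acts_componentwise \<phi> f \<longleftrightarrow> (\<forall>r i. \<phi> r $ i = f i (r $ i))"

definition componentwise_nonexpansive :: "(real^'q \<Rightarrow> real^'q) \<Rightarrow> bool" where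
  "componentwise_nonexpansive \<phi> \<longleftrightarrow>
     (\<exists>f. acts_componentwise \<phi> f) \<and>
     (\<forall>r s i. \<bar>\<phi> r $ i - \<phi> s $ i\<bar> \<le> \<bar>r $ i - s $ i\<bar>)"

definition static_sector :: "(real^'q \<Rightarrow> real^'q) \<Rightarrow> real^'q^'q \<Rightarrow> real^'q^'q \<Rightarrow> bool" where
  "static_sector \<phi> D0 D1 \<longleftrightarrow>
     \<phi> 0 = 0 \<and> diag_matrix D0 \<and> diag_matrix D1 \<and>
     (\<forall>i. 0 \<le> D0 $ i $ i \<and> D0 $ i $ i \<le> D1 $ i $ i \<and> D1 $ i $ i \<le> 1) \<and>
     (\<exists>f. acts_componentwise \<phi> f \<and>
        (\<forall>i z. (f i z - D0 $ i $ i * z) * (D1 $ i $ i * z - f i z) \<ge> 0))"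

section \<open>Closed loop and discounted cost\<close>

definition closed_loop ::
  "real^'n^'n \<Rightarrow> real^'m^'n \<Rightarrow> real^'n^'p \<Rightarrow> real^'p^'m \<Rightarrow> real^'q^'m \<Rightarrow> real^'q^'q \<Rightarrow> real^'p^'q \<Rightarrow>
   (real^'q \<Rightarrow> real^'q) \<Rightarrow>
   (nat \<Rightarrow> real^'n) \<Rightarrow> (nat \<Rightarrow> real^'p) \<Rightarrow> (nat \<Rightarrow> real^'q) \<Rightarrow> (nat \<Rightarrow> real^'m) \<Rightarrow> bool" where
  "closed_loop Ap Bp Cp K V W U \<phi> x y \<eta> u \<longleftrightarrow>
     (\<forall>k. x (Suc k) = Ap *v x k + Bp *v u k \<and>
          y k = Cp *v x k \<and>
          \<eta> k = \<phi> (W *v \<eta> k + U *v y k) \<and>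
          u k = K *v y k + V *v \<eta> k)"

definition discounted_stage_cost ::
  "real \<Rightarrow> real^'n^'n \<Rightarrow> real^'m^'m \<Rightarrow> (nat \<Rightarrow> real^'n) \<Rightarrow> (nat \<Rightarrow> real^'m) \<Rightarrow> nat \<Rightarrow> real" where
  "discounted_stage_cost \<beta> Q R x u k = \<beta> ^ k * (x k \<bullet> (Q *v x k) + u k \<bullet> (R *v u k))"

definition discounted_cost ::
  "real \<Rightarrow> real^'n^'n \<Rightarrow> real^'m^'m \<Rightarrow> (nat \<Rightarrow> real^'n) \<Rightarrow> (nat \<Rightarrow> real^'m) \<Rightarrow> real" where
  "discounted_cost \<beta> Q R x u = (\<Sum>k. discounted_stage_cost \<beta> Q R x u k)"

section \<open>Moments of random vectors\<close>

definition outer_prod :: "real^'n \<Rightarrow> real^'n^'n" where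
  "outer_prod v = (\<chi> i j. v $ i * v $ j)"

definition second_moment :: "'w measure \<Rightarrow> ('w \<Rightarrow> real^'n) \<Rightarrow> real^'n^'n" where
  "second_moment M X = (\<integral>\<omega>. outer_prod (X \<omega>) \<partial>M)"

definition mean :: "'w measure \<Rightarrow> ('w \<Rightarrow> real^'n) \<Rightarrow> real^'n" where
  "mean M X = (\<integral>\<omega>. X \<omega> \<partial>M)"

definition covariance :: "'w measure \<Rightarrow> ('w \<Rightarrow> real^'n) \<Rightarrow> real^'n^'n" where
  "covariance M X = (\<integral>\<omega>. outer_prod (X \<omega> - mean M X) \<partial>M)"

end

theory Submission
  imports Defs
begin

text \<open>
  Along a trajectory, evaluating the matrix inequality at the stacked vector of \<open>x\<^sub>k\<close> and \<open>\<eta>\<^sub>k\<close>,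
  where the sector multiplier is nonnegative, shows that \<open>x \<mapsto> x \<bullet> P x\<close> is a storage function for
  the discounted cost; telescoping gives the deterministic bound.

  Well-posedness of the implicit equation rests on one comparison principle for \<open>A = \<bar>W\<bar>\<close>:
  \<open>u \<le> A u\<close> forces \<open>u \<le> 0\<close>. It yields uniqueness, it makes the solution \<open>w\<close> of \<open>w = A w + \<bar>\<phi> b\<bar>\<close>
  nonnegative, so that Brouwer's theorem applies on the box \<open>[-w, w]\<close>, and it bounds the
  difference of two solutions linearly in the difference of the inputs. The resulting continuity of the
  solution map makes the random cost measurable, so that the pathwise bound can be integrated.
\<close>

section \<open>Eigenvalues and the spectral radius\<close>

text \<open>Eigenvalues are the roots of a nonzero polynomial. Finiteness is what gives the
  \<open>Max\<close> in \<open>spectral_radius\<close> its usual meaning.\<close>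

lemma finite_complex_eigenvalues: "finite (complex_eigenvalues A)"
proof -
  define C where "C = (\<chi> i j. complex_of_real (A $ i $ j))"
  define B where "B c = (\<chi> i j. C $ i $ j - (if i = j then c else 0))" for c
  \<comment> \<open>The characteristic polynomial up to sign: a determinant over the polynomial ring
    whose diagonal entries are \<open>C $ i $ i\<close> minus the indeterminate.\<close>
  define p where "p = det (\<chi> i j. [:C $ i $ j, if i = j then - 1 else 0:])"
  have poly_p: "poly p c = det (B c)" for c
    unfolding p_def det_def B_def poly_sum
    by (intro sum.cong refl) (auto simp: poly_prod intro!: prod.cong)
  have B_mult: "B c *v v = C *v v - c *s v" for c v
    by (simp add: B_def vec_eq_iff matrix_vector_mult_def left_diff_distrib sum_subtractf
        if_distrib [of "\<lambda>x. x * _"] cong: if_cong)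
  have eig_iff: "c \<in> complex_eigenvalues A \<longleftrightarrow> poly p c = 0" for c
  proof -
    have "c \<in> complex_eigenvalues A \<longleftrightarrow> (\<exists>v. v \<noteq> 0 \<and> B c *v v = 0)"
      by (simp add: complex_eigenvalues_def B_mult C_def)
    also have "\<dots> \<longleftrightarrow> \<not> invertible (B c)"
      unfolding invertible_left_inverse matrix_left_invertible_ker by blast
    finally show ?thesis
      by (simp add: invertible_det_nz poly_p)
  qed
  have "p \<noteq> 0"
  proof
    assume "p = 0"
    \<comment> \<open>Chosen so that \<open>b - 1\<close> bounds every absolute row sum. If
      \<open>b\<close> were an eigenvalue, the row of the entry of \<open>v\<close> with largest
      modulus would give \<open>b * norm (v $ i)\<close> at most
      \<open>(b - 1) * norm (v $ i)\<close>.\<close>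
    define b where "b = (\<Sum>i\<in>UNIV. \<Sum>j\<in>UNIV. norm (C $ i $ j)) + 1"
    have b_pos: "b > 0"
      unfolding b_def by (intro add_nonneg_pos sum_nonneg) auto
    have "complex_of_real b \<in> complex_eigenvalues A"
      by (simp add: eig_iff \<open>p = 0\<close>)
    then obtain v where v: "v \<noteq> 0" "C *v v = complex_of_real b *s v"
      by (auto simp: complex_eigenvalues_def C_def)
    obtain i where i: "\<And>j. norm (v $ j) \<le> norm (v $ i)"
    proof -
      have "Max (range (\<lambda>j. norm (v $ j))) \<in> range (\<lambda>j. norm (v $ j))"
        by (intro Max_in) auto
      then obtain i where "Max (range (\<lambda>j. norm (v $ j))) = norm (v $ i)"
        by blast
      then show ?thesis
        using that[of i] by (metis Max_ge finite finite_imageI rangeI)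
    qed
    have vi: "norm (v $ i) > 0"
    proof (rule ccontr)
      assume "\<not> ?thesis"
      then have "norm (v $ j) = 0" for j
        using i[of j] norm_ge_zero[of "v $ j"] by linarith
      with v(1) show False by (simp add: vec_eq_iff)
    qed
    have "b * norm (v $ i) = norm ((C *v v) $ i)"
      using b_pos by (simp add: v(2) norm_mult)
    also have "\<dots> \<le> (\<Sum>j\<in>UNIV. norm (C $ i $ j * v $ j))"
      by (simp add: matrix_vector_mult_def sum_norm_le)
    also have "\<dots> \<le> (\<Sum>j\<in>UNIV. norm (C $ i $ j) * norm (v $ i))"
      by (intro sum_mono) (auto simp: norm_mult intro!: mult_left_mono i)
    also have "\<dots> = (\<Sum>j\<in>UNIV. norm (C $ i $ j)) * norm (v $ i)"
      by (simp add: sum_distrib_right)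
    also have "(\<Sum>j\<in>UNIV. norm (C $ i $ j)) \<le> b - 1"
      unfolding b_def
      using member_le_sum[of i UNIV "\<lambda>i. \<Sum>j\<in>UNIV. norm (C $ i $ j)"]
      by (simp add: sum_nonneg)
    finally show False
      using vi by (simp add: mult_right_mono)
  qed
  then have "finite {c. poly p c = 0}"
    by (rule poly_roots_finite)
  then show ?thesis
    by (simp add: eig_iff[symmetric])
qed

text \<open>The real eigenvector, read as a complex vector, puts \<open>r\<close> among the
  eigenvalues over which the maximum is taken. This later excludes real eigenvalues that are at
  least 1.\<close>

lemma real_eigenvalue_le_spectral_radius:
  assumes "v \<noteq> 0" and "A *v v = r *\<^sub>R v"
  shows "\<bar>r\<bar> \<le> spectral_radius A"
proof -
  have "(\<chi> i. complex_of_real (v $ i)) \<noteq> 0"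
    using assms(1) by (auto simp: vec_eq_iff)
  moreover have "(\<chi> i j. complex_of_real (A $ i $ j)) *v (\<chi> i. complex_of_real (v $ i))
      = complex_of_real r *s (\<chi> i. complex_of_real (v $ i))"
  proof -
    have "(\<Sum>j\<in>UNIV. A $ i $ j * v $ j) = r * v $ i" for i
      using arg_cong[OF assms(2), of "\<lambda>w. w $ i"] by (simp add: matrix_vector_mult_def)
    then have "(\<Sum>j\<in>UNIV. complex_of_real (A $ i $ j) * complex_of_real (v $ j))
        = complex_of_real r * complex_of_real (v $ i)" for i
      by (metis (no_types, lifting) of_real_mult of_real_sum sum.cong)
    then show ?thesis
      by (simp add: vec_eq_iff matrix_vector_mult_def)
  qed
  ultimately have "complex_of_real r \<in> complex_eigenvalues A"
    unfolding complex_eigenvalues_def by blast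
  then have "norm (complex_of_real r) \<le> spectral_radius A"
    unfolding spectral_radius_def by (intro Max_ge finite_imageI finite_complex_eigenvalues imageI)
  then show ?thesis by simp
qed

section \<open>Nonnegative matrices and the comparison principle\<close>

lemma nonneg_matrix_vector_mono:
  fixes A :: "real^'a^'b"
  assumes "\<And>i j. 0 \<le> A $ i $ j" and "u \<le> w"
  shows "A *v u \<le> A *v w"
  using assms by (auto simp: less_eq_vec_def matrix_vector_mult_def intro!: sum_mono mult_left_mono)

lemma abs_matrix_vector_le: "\<bar>A *v u\<bar> \<le> abs_matrix A *v \<bar>u\<bar>"
  by (auto simp: less_eq_vec_def abs_vec_def matrix_vector_mult_def abs_matrix_def abs_mult[symmetric])

text \<open>A Perron--Frobenius argument: Brouwer's theorem applied to the normalised map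
  \<open>x \<mapsto> A x\<close> on the part of the simplex where \<open>x \<le> A x\<close>.\<close>

lemma subinvariant_imp_eigenvalue_ge_1:
  fixes A :: "real^'a^'a"
  assumes A: "\<And>i j. 0 \<le> A $ i $ j"
    and d: "0 \<le> d" "d \<noteq> 0" "d \<le> A *v d"
  shows "\<exists>r\<ge>1. \<exists>v. v \<noteq> 0 \<and> A *v v = r *\<^sub>R v"
proof -
  define s where "s x = (\<Sum>i\<in>UNIV. x $ i)" for x :: "real^'a"
  have s_lin: "s (a *\<^sub>R x + b *\<^sub>R y) = a * s x + b * s y" for a b x y
    by (simp add: s_def sum.distrib sum_distrib_left)
  have s_scale: "s (a *\<^sub>R x) = a * s x" for a x
    by (simp add: s_def sum_distrib_left)
  have s_mono: "s x \<le> s y" if "x \<le> y" for x y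
    using that by (auto simp: s_def less_eq_vec_def intro: sum_mono)
  have s_cont: "continuous_on T s" for T
    unfolding s_def by (intro continuous_intros)
  \<comment> \<open>The constraint \<open>x \<le> A *v x\<close> forces \<open>s (A *v x)\<close> to
    be at least 1 on \<open>S\<close>. So the normalisation below never divides by zero, and the
    eigenvalue found is at least 1.\<close>
  define S where "S = {x. 0 \<le> x \<and> s x = 1 \<and> x \<le> A *v x}"
  have "s d > 0"
  proof -
    obtain i where "d $ i \<noteq> 0"
      using d(2) by (auto simp: vec_eq_iff)
    with d(1) show ?thesis
      unfolding s_def by (intro sum_pos2[of _ i]) (auto simp: less_eq_vec_def less_le)
  qed
  then have "(1 / s d) *\<^sub>R d \<in> S"
    using d unfolding S_def
    by (auto simp: s_scale less_eq_vec_def matrix_vector_mult_scaleR divide_right_mono)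
  then have ne: "S \<noteq> {}" by blast
  have cl: "closed S"
  proof -
    have "S = (\<Inter>i. {x. 0 \<le> x $ i}) \<inter> {x. s x = 1} \<inter> (\<Inter>i. {x. x $ i \<le> (A *v x) $ i})"
      by (auto simp: S_def less_eq_vec_def)
    also have "closed \<dots>"
      by (intro closed_Int closed_INT ballI closed_Collect_le closed_Collect_eq s_cont
          continuous_intros)
    finally show ?thesis .
  qed
  have "S \<subseteq> cbox 0 1"
  proof
    fix x assume x: "x \<in> S"
    then have "x $ i \<le> 1" for i
      using member_le_sum[of i UNIV "\<lambda>i. x $ i"] by (auto simp: S_def s_def less_eq_vec_def)
    with x show "x \<in> cbox 0 1"
      by (auto simp: S_def mem_box_cart less_eq_vec_def)
  qed
  then have bd: "bounded S"
    by (rule bounded_subset[OF bounded_cbox])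
  have conv: "convex S"
  proof (rule convexI)
    fix x y :: "real^'a" and a b :: real
    assume *: "x \<in> S" "y \<in> S" "0 \<le> a" "0 \<le> b" "a + b = 1"
    then show "a *\<^sub>R x + b *\<^sub>R y \<in> S"
      by (auto simp: S_def s_lin matrix_vector_right_distrib matrix_vector_mult_scaleR
          less_eq_vec_def intro!: add_mono mult_left_mono)
  qed
  have sA: "1 \<le> s (A *v x)" if "x \<in> S" for x
    using that s_mono[of x "A *v x"] by (auto simp: S_def)
  define f where "f x = (1 / s (A *v x)) *\<^sub>R (A *v x)" for x
  have "continuous_on S f"
    unfolding f_def
    by (intro continuous_intros continuous_on_compose2[OF s_cont[of UNIV]]) (use sA in fastforce)+
  moreover have "f \<in> S \<rightarrow> S"
  proof
    fix x assume x: "x \<in> S"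
    have pos: "s (A *v x) > 0" using sA[OF x] by linarith
    have "0 \<le> A *v x" "A *v x \<le> A *v (A *v x)"
      using x nonneg_matrix_vector_mono[OF A, of x "A *v x"] by (auto simp: S_def)
    with pos show "f x \<in> S"
      by (auto simp: S_def f_def s_scale matrix_vector_mult_scaleR less_eq_vec_def divide_right_mono)
  qed
  ultimately obtain x where x: "x \<in> S" "f x = x"
    using brouwer[of S f] cl bd conv ne by (auto simp: compact_eq_bounded_closed)
  \<comment> \<open>Since \<open>f x = x\<close>, this is the eigenvalue equation with eigenvalue
    \<open>s (A *v x)\<close>.\<close>
  have "A *v x = s (A *v x) *\<^sub>R f x"
    using sA[OF x(1)] by (simp add: f_def)
  moreover have "x \<noteq> 0"
    using x(1) by (auto simp: S_def s_def)
  ultimately show ?thesis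
    using sA[OF x(1)] x(2) by auto
qed

text \<open>The positive part \<open>d\<close> of \<open>u\<close> satisfies
  \<open>d \<le> A *v d\<close> by monotonicity; were it nonzero, \<open>A\<close> would have an
  eigenvalue of at least 1.\<close>

lemma subinvariant_le_zero:
  fixes A :: "real^'a^'a"
  assumes A: "\<And>i j. 0 \<le> A $ i $ j" and radius: "spectral_radius A < 1"
    and u: "u \<le> A *v u"
  shows "u \<le> 0"
proof -
  define d where "d = sup u 0"
  have "0 \<le> A *v d"
    using nonneg_matrix_vector_mono[OF A, of 0 d] by (simp add: d_def)
  moreover have "u \<le> A *v d"
    using u nonneg_matrix_vector_mono[OF A, of u d] by (simp add: d_def order_trans)
  ultimately have "d \<le> A *v d"
    by (simp add: d_def)
  moreover have "0 \<le> d"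
    by (simp add: d_def)
  ultimately have "d = 0"
    using subinvariant_imp_eigenvalue_ge_1[of A d] A radius
      real_eigenvalue_le_spectral_radius[of _ A] by fastforce
  then show ?thesis
    by (metis d_def sup.cobounded1)
qed

text \<open>\<open>N\<close> is the inverse of \<open>mat 1 - A\<close>, which is invertible because
  a kernel vector would be an eigenvector for the eigenvalue 1.\<close>

lemma resolvent_exists:
  fixes A :: "real^'a^'a"
  assumes A: "\<And>i j. 0 \<le> A $ i $ j" and radius: "spectral_radius A < 1"
  obtains N where "\<And>b. N *v b = A *v (N *v b) + b"
proof -
  have "x = 0" if "(mat 1 - A) *v x = 0" for x
  proof -
    from that have "A *v x = 1 *\<^sub>R x"
      by (simp add: matrix_vector_mult_diff_rdistrib)
    then show ?thesis
      using real_eigenvalue_le_spectral_radius[of x A 1] radius by auto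
  qed
  then have "invertible (mat 1 - A)"
    unfolding invertible_left_inverse matrix_left_invertible_ker by blast
  then obtain N where "(mat 1 - A) ** N = mat 1"
    by (auto simp: invertible_def)
  then have "(mat 1 - A) *v (N *v b) = b" for b
    by (simp add: matrix_vector_mul_assoc)
  then have "N *v b = A *v (N *v b) + b" for b
    by (metis diff_add_cancel add.commute matrix_vector_mult_diff_rdistrib matrix_vector_mul_lid)
  then show ?thesis by (rule that)
qed

section \<open>Well-posedness of the implicit equation\<close>

text \<open>Varying both state and input serves two purposes: comparing two solutions, and, with
  \<open>s = 0\<close> and equal inputs, showing that the box is mapped into itself.\<close>

lemma nonexpansive_comp_matrix:
  assumes "componentwise_nonexpansive \<phi>"
  shows "\<bar>\<phi> (W *v r + b) - \<phi> (W *v s + c)\<bar> \<le> abs_matrix W *v \<bar>r - s\<bar> + \<bar>b - c\<bar>"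
proof -
  have "\<bar>\<phi> (W *v r + b) - \<phi> (W *v s + c)\<bar> \<le> \<bar>(W *v r + b) - (W *v s + c)\<bar>"
    using assms unfolding componentwise_nonexpansive_def less_eq_vec_def abs_vec_def
    by (simp only: vector_minus_component vec_lambda_beta simp_thms)
  also have "\<dots> = \<bar>W *v (r - s) + (b - c)\<bar>"
    by (simp add: matrix_vector_mult_diff_distrib algebra_simps)
  also have "\<dots> \<le> \<bar>W *v (r - s)\<bar> + \<bar>b - c\<bar>"
    by (auto simp: less_eq_vec_def abs_vec_def)
  also have "\<dots> \<le> abs_matrix W *v \<bar>r - s\<bar> + \<bar>b - c\<bar>"
    by (intro add_right_mono abs_matrix_vector_le)
  finally show ?thesis .
qed

lemma abs_matrix_nonneg: "0 \<le> abs_matrix A $ i $ j"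
  by (simp add: abs_matrix_def)

text \<open>The excess \<open>e\<close> of the left side over the right satisfies
  \<open>e \<le> abs_matrix W *v e\<close>, so the comparison principle makes it
  nonpositive.\<close>

lemma implicit_equation_lipschitz:
  assumes ne: "componentwise_nonexpansive \<phi>"
    and radius: "spectral_radius (abs_matrix W) < 1"
    and N: "\<And>b. N *v b = abs_matrix W *v (N *v b) + b"
    and r: "r = \<phi> (W *v r + b)" and s: "s = \<phi> (W *v s + c)"
  shows "\<bar>r - s\<bar> \<le> N *v \<bar>b - c\<bar>"
proof -
  define e where "e = \<bar>r - s\<bar> - N *v \<bar>b - c\<bar>"
  have "\<bar>r - s\<bar> \<le> abs_matrix W *v \<bar>r - s\<bar> + \<bar>b - c\<bar>"
    using nonexpansive_comp_matrix[OF ne, of W r b s c] r s by simp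
  then have "e \<le> abs_matrix W *v \<bar>r - s\<bar> + \<bar>b - c\<bar> - N *v \<bar>b - c\<bar>"
    unfolding e_def by (rule diff_right_mono)
  also have "\<dots> = abs_matrix W *v e"
    using N[of "\<bar>b - c\<bar>"] by (simp add: e_def matrix_vector_mult_diff_distrib algebra_simps)
  finally have "e \<le> 0"
    by (intro subinvariant_le_zero[OF abs_matrix_nonneg radius])
  then show ?thesis by (simp add: e_def)
qed

lemma implicit_equation_unique_solution:
  assumes ne: "componentwise_nonexpansive \<phi>"
    and radius: "spectral_radius (abs_matrix W) < 1"
  shows "\<exists>!r. r = \<phi> (W *v r + b)"
proof -
  define A where "A = abs_matrix W"
  obtain N where N: "\<And>b. N *v b = A *v (N *v b) + b"
    using resolvent_exists[OF abs_matrix_nonneg radius] unfolding A_def by metis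
  \<comment> \<open>The half-widths of the box: \<open>\<bar>r\<bar> \<le> w\<close> bounds the
    image of \<open>r\<close> by \<open>A *v w + \<bar>\<phi> b\<bar>\<close>, which is exactly
    \<open>w\<close>.\<close>
  define w where "w = N *v \<bar>\<phi> b\<bar>"
  have w: "w = A *v w + \<bar>\<phi> b\<bar>"
    unfolding w_def by (rule N)
  have "A *v (- w) = - (A *v w)"
    using matrix_vector_mult_diff_distrib[of A 0 w] by simp
  then have "- w = A *v (- w) - \<bar>\<phi> b\<bar>"
    using w by (metis add.inverse_distrib_swap diff_conv_add_uminus add.commute)
  \<comment> \<open>The comparison principle applied to \<open>- w\<close> gives
    \<open>0 \<le> w\<close>, so the box contains 0 and is nonempty.\<close>
  then have "- w \<le> A *v (- w)"
    by (metis abs_ge_zero diff_le_eq le_add_same_cancel1)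
  then have "- w \<le> 0"
    unfolding A_def by (intro subinvariant_le_zero[OF abs_matrix_nonneg radius])
  then have w_nonneg: "0 \<le> w" by simp
  define S where "S = cbox (- w) w"
  have S_iff: "r \<in> S \<longleftrightarrow> \<bar>r\<bar> \<le> w" for r
    by (auto simp: S_def mem_box_cart less_eq_vec_def abs_vec_def abs_le_iff)
      (metis add.inverse_inverse neg_le_iff_le)+
  have "continuous_on S (\<lambda>r. \<phi> (W *v r + b))"
  proof -
    have "norm (\<phi> r - \<phi> s) \<le> 1 * norm (r - s)" for r s
      using ne by (auto simp: componentwise_nonexpansive_def intro!: norm_le_componentwise_cart)
    then have "continuous_on UNIV \<phi>"
      by (intro lipschitz_on_continuous_on[of 1] lipschitz_onI) (auto simp: dist_norm)
    then show ?thesis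
      by (rule continuous_on_compose2) (auto intro!: continuous_intros)
  qed
  moreover have "(\<lambda>r. \<phi> (W *v r + b)) \<in> S \<rightarrow> S"
  proof
    fix r assume "r \<in> S"
    then have r: "\<bar>r\<bar> \<le> w" by (simp add: S_iff)
    have "\<bar>\<phi> (W *v r + b)\<bar> \<le> \<bar>\<phi> (W *v r + b) - \<phi> b\<bar> + \<bar>\<phi> b\<bar>"
      by (auto simp: less_eq_vec_def abs_vec_def)
    also have "\<dots> \<le> A *v \<bar>r\<bar> + \<bar>\<phi> b\<bar>"
      using nonexpansive_comp_matrix[OF ne, of W r b 0 b] by (simp add: A_def)
    also have "\<dots> \<le> A *v w + \<bar>\<phi> b\<bar>"
      unfolding A_def by (intro add_right_mono nonneg_matrix_vector_mono abs_matrix_nonneg r)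
    also have "\<dots> = w" by (rule w[symmetric])
    finally show "\<phi> (W *v r + b) \<in> S" by (simp add: S_iff)
  qed
  moreover have "0 \<in> S"
    using w_nonneg by (simp add: S_iff)
  ultimately obtain r where r: "\<phi> (W *v r + b) = r"
    using brouwer[of S "\<lambda>r. \<phi> (W *v r + b)"] unfolding S_def
    by (metis compact_cbox convex_box(1) empty_iff)
  moreover have "s = r" if "s = \<phi> (W *v s + b)" for s
  proof -
    \<comment> \<open>Equal inputs turn the Lipschitz bound into \<open>N *v 0\<close>.\<close>
    have "\<bar>s - r\<bar> \<le> 0"
      using implicit_equation_lipschitz[OF ne radius N[unfolded A_def] that r[symmetric]] by simp
    then show ?thesis by simp
  qed
  ultimately show ?thesis by metis
qed

text \<open>Each component of \<open>h b - h c\<close> is squeezed by the same component of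
  \<open>N *v \<bar>b - c\<bar>\<close>, which vanishes as \<open>b\<close> tends to
  \<open>c\<close>.\<close>

lemma implicit_equation_solution_continuous:
  assumes ne: "componentwise_nonexpansive \<phi>"
    and radius: "spectral_radius (abs_matrix W) < 1"
    and sol: "\<And>b. h b = \<phi> (W *v h b + b)"
  shows "continuous_on UNIV h"
proof -
  obtain N where N: "\<And>b. N *v b = abs_matrix W *v (N *v b) + b"
    using resolvent_exists[OF abs_matrix_nonneg radius] by metis
  have "(\<lambda>b. h b $ i) \<midarrow>c\<rightarrow> h c $ i" for c i
  proof -
    have "((\<lambda>b. \<Sum>j\<in>UNIV. N $ i $ j * \<bar>b $ j - c $ j\<bar>) \<longlongrightarrow>
        (\<Sum>j\<in>UNIV. N $ i $ j * \<bar>c $ j - c $ j\<bar>)) (at c)"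
      by (intro tendsto_intros)
    then have "((\<lambda>b. \<Sum>j\<in>UNIV. N $ i $ j * \<bar>b $ j - c $ j\<bar>) \<longlongrightarrow> 0) (at c)"
      by simp
    moreover have "\<forall>\<^sub>F b in at c. norm (h b $ i - h c $ i)
        \<le> (\<Sum>j\<in>UNIV. N $ i $ j * \<bar>b $ j - c $ j\<bar>)"
    proof (rule always_eventually, rule allI)
      fix b
      show "norm (h b $ i - h c $ i) \<le> (\<Sum>j\<in>UNIV. N $ i $ j * \<bar>b $ j - c $ j\<bar>)"
        using implicit_equation_lipschitz[OF ne radius N sol sol, of b c]
        by (simp add: less_eq_vec_def abs_vec_def matrix_vector_mult_def)
    qed
    ultimately have "((\<lambda>b. h b $ i - h c $ i) \<longlongrightarrow> 0) (at c)"
      by (rule Lim_null_comparison[rotated])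
    then show ?thesis
      by (rule LIM_zero_cancel)
  qed
  then show ?thesis
    unfolding continuous_on_def by (intro ballI vec_tendstoI) simp
qed

section \<open>Block matrices, quadratic forms and the sector multiplier\<close>

lemma sum_UNIV_Plus:
  fixes g :: "'a::finite + 'b::finite \<Rightarrow> 'c::comm_monoid_add"
  shows "(\<Sum>k\<in>UNIV. g k) = (\<Sum>i\<in>UNIV. g (Inl i)) + (\<Sum>j\<in>UNIV. g (Inr j))"
  using sum.Plus[of UNIV UNIV g] by (simp add: comp_def)

lemma block_row_mult_vector:
  "block_row A B *v (\<chi> k. case k of Inl i \<Rightarrow> a $ i | Inr j \<Rightarrow> b $ j) = A *v a + B *v b"
  by (simp add: vec_eq_iff block_row_def matrix_vector_mult_def sum_UNIV_Plus)

text \<open>Turns each congruence term of the matrix inequality into a form in the signals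
  \<open>x\<close>, \<open>u\<close> and \<eta>.\<close>

lemma inner_congruence:
  fixes A :: "real^'a^'b"
  shows "v \<bullet> ((transpose A ** B ** C) *v w) = (A *v v) \<bullet> (B *v (C *v w))"
  by (metis dot_lmul_matrix matrix_vector_mul_assoc transpose_matrix_vector transpose_transpose)

lemma inner_He: "v \<bullet> (He A *v v) = 2 * (v \<bullet> (A *v v))"
proof -
  have "v \<bullet> (transpose A *v v) = v \<bullet> (A *v v)"
    by (metis dot_lmul_matrix inner_commute transpose_matrix_vector)
  then show ?thesis
    by (simp add: He_def matrix_vector_mult_add_rdistrib inner_add_right)
qed

lemma diag_matrix_mult_vector:
  assumes "diag_matrix A"
  shows "(A *v v) $ i = A $ i $ i * v $ i"
proof -
  have "(A *v v) $ i = (\<Sum>j\<in>UNIV. if j = i then A $ i $ i * v $ i else 0)"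
    using assms unfolding matrix_vector_mult_def diag_matrix_def vec_lambda_beta
    by (intro sum.cong) auto
  then show ?thesis by simp
qed

lemma scaleR_matrix_vector: "(c *\<^sub>R A) *v v = c *\<^sub>R ((A :: real^'a^'b) *v v)"
  by (simp add: scaleR_matrix_vector_assoc)

lemma uminus_matrix_vector: "(- A) *v v = - ((A :: real^'a^'b) *v v)"
  using scaleR_matrix_vector[of "- 1" A v] by simp

text \<open>With \<open>D0\<close>, \<open>D1\<close> and \<open>L\<close> diagonal, the quadratic
  form splits into a sum over the components of \<open>2 * L $ i $ i\<close> times the product in
  the sector condition.\<close>

lemma sector_multiplier_nonneg:
  assumes sector: "static_sector \<phi> D0 D1"
    and L: "diag_matrix L" "0 \<preceq>\<^sub>L L"
    and M: "M = - (2 *\<^sub>R (transpose Z ** D0 ** L ** D1 ** Z))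
                + He (transpose H ** L ** (D0 + D1) ** Z)
                - 2 *\<^sub>R (transpose H ** L ** H)"
    and v: "H *v v = \<phi> (Z *v v)"
  shows "0 \<le> v \<bullet> (M *v v)"
proof -
  define z where "z = Z *v v"
  define \<eta> where "\<eta> = H *v v"
  have D: "diag_matrix D0" "diag_matrix D1"
    using sector by (auto simp: static_sector_def)
  have L_nonneg: "0 \<le> L $ i $ i" for i
  proof -
    \<comment> \<open>Testing semidefiniteness on a unit vector isolates a diagonal entry.\<close>
    have "0 \<le> axis i 1 \<bullet> (L *v axis i 1)"
      using L(2) by (auto simp: loewner_le_def)
    then show ?thesis
      by (simp add: inner_axis' diag_matrix_mult_vector[OF L(1)])
  qed
  have "v \<bullet> (M *v v) =
      - 2 * (z \<bullet> (D0 *v (L *v (D1 *v z)))) + 2 * (\<eta> \<bullet> (L *v (D0 *v z + D1 *v z)))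
      - 2 * (\<eta> \<bullet> (L *v \<eta>))"
  proof -
    \<comment> \<open>The inner factors are bracketed so that \<open>inner_congruence\<close>
      matches; associativity then restores the form that occurs in \<open>M\<close>.\<close>
    have "v \<bullet> ((transpose Z ** (D0 ** L ** D1) ** Z) *v v)
        = z \<bullet> ((D0 ** L ** D1) *v z)"
      by (simp only: inner_congruence z_def)
    then have 1: "v \<bullet> ((transpose Z ** D0 ** L ** D1 ** Z) *v v)
        = z \<bullet> (D0 *v (L *v (D1 *v z)))"
      by (simp only: matrix_mul_assoc matrix_vector_mul_assoc)
    have "v \<bullet> ((transpose H ** (L ** (D0 + D1)) ** Z) *v v)
        = \<eta> \<bullet> ((L ** (D0 + D1)) *v z)"
      by (simp only: inner_congruence z_def \<eta>_def)
    then have 2: "v \<bullet> ((transpose H ** L ** (D0 + D1) ** Z) *v v)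
        = \<eta> \<bullet> (L *v (D0 *v z + D1 *v z))"
      by (simp only: matrix_mul_assoc matrix_vector_mul_assoc
          matrix_vector_mult_add_rdistrib[symmetric])
    have 3: "v \<bullet> ((transpose H ** L ** H) *v v) = \<eta> \<bullet> (L *v \<eta>)"
      by (simp only: inner_congruence \<eta>_def)
    show ?thesis
      unfolding M by (simp only: matrix_vector_mult_diff_rdistrib matrix_vector_mult_add_rdistrib
          inner_diff_right inner_add_right uminus_matrix_vector inner_minus_right inner_scaleR_right inner_He
          scaleR_matrix_vector 1 2 3 mult_minus_left)
  qed
  also have "\<dots> = (\<Sum>i\<in>UNIV. 2 * (L $ i $ i *
      ((\<eta> $ i - D0 $ i $ i * z $ i) * (D1 $ i $ i * z $ i - \<eta> $ i))))"
    unfolding inner_vec_def sum_distrib_left sum.distrib[symmetric] sum_subtractf[symmetric]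
    by (intro sum.cong refl)
      (simp add: diag_matrix_mult_vector D L(1) algebra_simps)
  also have "\<dots> \<ge> 0"
  proof (rule sum_nonneg)
    fix i
    have "\<eta> = \<phi> z"
      using v by (simp only: z_def \<eta>_def)
    with sector have "0 \<le> (\<eta> $ i - D0 $ i $ i * z $ i) * (D1 $ i $ i * z $ i - \<eta> $ i)"
      unfolding static_sector_def acts_componentwise_def by metis
    then show "0 \<le> 2 * (L $ i $ i *
        ((\<eta> $ i - D0 $ i $ i * z $ i) * (D1 $ i $ i * z $ i - \<eta> $ i)))"
      using mult_nonneg_nonneg[OF L_nonneg] by simp
  qed
  finally show ?thesis .
qed

section \<open>Discounted dissipation\<close>

text \<open>Weighting the dissipation inequality by \<open>\<beta> ^ k\<close> makes it telescope;
  the remainder \<open>\<beta> ^ n * V n\<close> is nonnegative, so the partial sums stay below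
  \<open>V 0\<close>.\<close>

lemma discounted_sum_le_storage:
  fixes V c :: "nat \<Rightarrow> real"
  assumes "0 < \<beta>" and V: "\<And>k. 0 \<le> V k" and c: "\<And>k. 0 \<le> c k"
    and dissipation: "\<And>k. \<beta> * V (Suc k) + c k \<le> V k"
  shows "summable (\<lambda>k. \<beta> ^ k * c k)" and "(\<Sum>k. \<beta> ^ k * c k) \<le> V 0"
proof -
  have "(\<Sum>k<n. \<beta> ^ k * c k) + \<beta> ^ n * V n \<le> V 0" for n
  proof (induction n)
    case (Suc n)
    have "\<beta> ^ n * (\<beta> * V (Suc n) + c n) \<le> \<beta> ^ n * V n"
      using \<open>0 < \<beta>\<close> dissipation by (intro mult_left_mono) auto
    with Suc show ?case
      by (simp add: algebra_simps)
  qed simp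
  moreover have "0 \<le> \<beta> ^ n * V n" for n
    using \<open>0 < \<beta>\<close> V by simp
  ultimately have le: "(\<Sum>k<n. \<beta> ^ k * c k) \<le> V 0" for n
    by (meson add_increasing2 le_add_same_cancel1 order_trans)
  show *: "summable (\<lambda>k. \<beta> ^ k * c k)"
    using \<open>0 < \<beta>\<close> c le by (intro summableI_nonneg_bounded[where x = "V 0"]) auto
  show "(\<Sum>k. \<beta> ^ k * c k) \<le> V 0"
    by (intro suminf_le_const * le)
qed

section \<open>Second moments and covariance\<close>

text \<open>Rewrites the form as a linear function of \<open>outer_prod v\<close>, through which an
  integral can be passed.\<close>

lemma quadratic_form_eq_trace: "v \<bullet> (P *v v) = trace (P ** outer_prod v)"
  unfolding trace_def matrix_matrix_mult_def outer_prod_def inner_vec_def matrix_vector_mult_def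
  by (simp add: sum_distrib_left mult_ac)

lemma bounded_linear_trace_mult: "bounded_linear (\<lambda>S. trace (P ** S))"
  for P :: "real^'n^'n"
  unfolding linear_conv_bounded_linear[symmetric]
  by (rule linearI) (simp_all add: trace_def matrix_matrix_mult_def
      distrib_left sum.distrib sum_distrib_left mult_ac)

lemma quadratic_form_moment:
  assumes "integrable M (\<lambda>\<omega>. outer_prod (X \<omega>))"
  shows "integrable M (\<lambda>\<omega>. X \<omega> \<bullet> (P *v X \<omega>))"
    and "(\<integral>\<omega>. X \<omega> \<bullet> (P *v X \<omega>) \<partial>M) = trace (P ** second_moment M X)"
  unfolding quadratic_form_eq_trace second_moment_def
  by (rule integrable_bounded_linear[OF bounded_linear_trace_mult assms],
      rule integral_bounded_linear[OF bounded_linear_trace_mult assms])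

lemma second_moment_eq_covariance:
  assumes "prob_space M" and X: "integrable M X"
    and C: "integrable M (\<lambda>\<omega>. outer_prod (X \<omega> - mean M X))"
  shows "integrable M (\<lambda>\<omega>. outer_prod (X \<omega>))"
    and "second_moment M X = covariance M X + outer_prod (mean M X)"
proof -
  interpret prob_space M by fact
  define \<mu> where "\<mu> = mean M X"
  \<comment> \<open>The cross terms in the expansion about the mean. \<open>T\<close> is linear, so
    its integral is \<open>T \<mu>\<close>, twice \<open>outer_prod \<mu>\<close>; subtracting the
    constant term leaves one copy.\<close>
  define T where "T x = (\<chi> i j. x $ i * \<mu> $ j + \<mu> $ i * x $ j)" for x
  have T: "bounded_linear T"
    unfolding linear_conv_bounded_linear[symmetric]
    by (rule linearI) (simp_all add: T_def vec_eq_iff algebra_simps)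
  have eq: "outer_prod (X \<omega>) = outer_prod (X \<omega> - \<mu>) + T (X \<omega>) - outer_prod \<mu>" for \<omega>
    by (simp add: T_def outer_prod_def vec_eq_iff algebra_simps)
  have ints: "integrable M (\<lambda>\<omega>. outer_prod (X \<omega> - \<mu>))" "integrable M (\<lambda>\<omega>. T (X \<omega>))"
    using C integrable_bounded_linear[OF T X] by (simp_all add: \<mu>_def)
  show "integrable M (\<lambda>\<omega>. outer_prod (X \<omega>))"
    unfolding eq by (intro Bochner_Integration.integrable_add Bochner_Integration.integrable_diff
        ints integrable_const)
  have "(\<integral>\<omega>. outer_prod (X \<omega>) \<partial>M)
      = (\<integral>\<omega>. outer_prod (X \<omega> - \<mu>) \<partial>M) + (\<integral>\<omega>. T (X \<omega>) \<partial>M) - outer_prod \<mu>"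
    unfolding eq using ints by (simp add: prob_space)
  also have "(\<integral>\<omega>. T (X \<omega>) \<partial>M) = T \<mu>"
    unfolding \<mu>_def mean_def by (rule integral_bounded_linear[OF T X])
  also have "T \<mu> = outer_prod \<mu> + outer_prod \<mu>"
    by (simp add: T_def outer_prod_def vec_eq_iff)
  finally show "second_moment M X = covariance M X + outer_prod (mean M X)"
    by (simp add: second_moment_def covariance_def \<mu>_def)
qed

section \<open>Measurability of the closed loop\<close>

text \<open>Uniqueness makes \<eta> the value of the continuous map \<open>h\<close> at the current
  input, so the control is a continuous function \<open>g\<close> of the state. Induction over time
  starts from the measurable initial state.\<close>

lemma closed_loop_measurable:
  fixes x :: "'w \<Rightarrow> nat \<Rightarrow> real^'n" and \<eta> :: "'w \<Rightarrow> nat \<Rightarrow> real^'q"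
  assumes unique: "\<And>b r. r = \<phi> (W *v r + b) \<Longrightarrow> r = h b"
    and h: "continuous_on UNIV h"
    and x0: "(\<lambda>\<omega>. x \<omega> 0) \<in> borel_measurable M"
    and loop: "\<And>\<omega>. \<omega> \<in> space M \<Longrightarrow>
      closed_loop Ap Bp Cp K V W U \<phi> (x \<omega>) (y \<omega>) (\<eta> \<omega>) (u \<omega>)"
  shows "(\<lambda>\<omega>. x \<omega> k) \<in> borel_measurable M" and "(\<lambda>\<omega>. u \<omega> k) \<in> borel_measurable M"
proof -
  note mult = bounded_linear.continuous_on[OF matrix_vector_mul_bounded_linear]
  define g where "g z = K *v (Cp *v z) + V *v h (U *v (Cp *v z))" for z
  have g: "continuous_on UNIV g"
    unfolding g_def
    by (intro continuous_on_add mult continuous_on_compose2[OF h] continuous_on_id) auto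
  have u_eq: "u \<omega> k = g (x \<omega> k)" if "\<omega> \<in> space M" for \<omega> k
  proof -
    have *: "y \<omega> k = Cp *v x \<omega> k" "\<eta> \<omega> k = \<phi> (W *v \<eta> \<omega> k + U *v y \<omega> k)"
      "u \<omega> k = K *v y \<omega> k + V *v \<eta> \<omega> k"
      using loop[OF that] unfolding closed_loop_def by blast+
    show ?thesis
      unfolding g_def using * unique[OF *(2)] by metis
  qed
  have u: "(\<lambda>\<omega>. u \<omega> k) \<in> borel_measurable M" if "(\<lambda>\<omega>. x \<omega> k) \<in> borel_measurable M" for k
  proof -
    have "(\<lambda>\<omega>. g (x \<omega> k)) \<in> borel_measurable M"
      by (rule borel_measurable_continuous_on[OF g that])
    then show ?thesis
      \<comment> \<open>The loop equations hold on \<open>space M\<close> only, hence the passage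
        through \<open>measurable_cong\<close>.\<close>
      using measurable_cong[of M "\<lambda>\<omega>. u \<omega> k" "\<lambda>\<omega>. g (x \<omega> k)" borel] u_eq by blast
  qed
  show x: "(\<lambda>\<omega>. x \<omega> k) \<in> borel_measurable M" for k
  proof (induction k)
    case (Suc k)
    have "(\<lambda>\<omega>. Ap *v x \<omega> k + Bp *v u \<omega> k) \<in> borel_measurable M"
      by (intro borel_measurable_add borel_measurable_continuous_on[OF _ Suc]
          borel_measurable_continuous_on[OF _ u[OF Suc]] continuous_intros)
    moreover have "x \<omega> (Suc k) = Ap *v x \<omega> k + Bp *v u \<omega> k" if "\<omega> \<in> space M" for \<omega>
      using loop[OF that] by (simp add: closed_loop_def)
    ultimately show ?case
      using measurable_cong[of M "\<lambda>\<omega>. x \<omega> (Suc k)" "\<lambda>\<omega>. Ap *v x \<omega> k + Bp *v u \<omega> k" borel]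
      by blast
  qed (rule x0)
  show "(\<lambda>\<omega>. u \<omega> k) \<in> borel_measurable M"
    by (rule u[OF x])
qed

lemma discounted_cost_measurable:
  assumes "\<And>k. (\<lambda>\<omega>. x \<omega> k) \<in> borel_measurable M" and "\<And>k. (\<lambda>\<omega>. u \<omega> k) \<in> borel_measurable M"
  shows "(\<lambda>\<omega>. discounted_cost \<beta> Q R (x \<omega>) (u \<omega>)) \<in> borel_measurable M"
  unfolding discounted_cost_def discounted_stage_cost_def
  by (intro borel_measurable_suminf borel_measurable_times borel_measurable_add
      borel_measurable_inner borel_measurable_const assms
      borel_measurable_continuous_on[OF _ assms(1)]
      borel_measurable_continuous_on[OF _ assms(2)] continuous_intros)

section \<open>The guaranteed-cost bound\<close>

text \<open>Summability and integrability are asserted together with the bounds, because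
  \<open>suminf\<close> and the Bochner integral are total and an inequality between their values
  alone would not show that the cost is finite.\<close>

theorem theorem4:
  fixes Ap :: "real^'n^'n" and Bp :: "real^'m^'n" and Cp :: "real^'n^'p"
    and K :: "real^'p^'m" and V :: "real^'q^'m"
    and W :: "real^'q^'q" and U :: "real^'p^'q"
    and \<phi> :: "real^'q \<Rightarrow> real^'q"
    and Q :: "real^'n^'n" and R :: "real^'m^'m" and \<beta> :: real
    and D0 D1 \<Lambda> :: "real^'q^'q" and P :: "real^'n^'n"
    and X :: "real^('n + 'q)^'n" and H :: "real^('n + 'q)^'q"
    and Z :: "real^('n + 'q)^'q" and F :: "real^('n + 'q)^'n"
    and G :: "real^('n + 'q)^'m" and M\<^sub>\<Lambda> :: "real^('n + 'q)^('n + 'q)"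
  assumes X: "X = block_row (mat 1) 0"
    and H: "H = block_row 0 (mat 1)"
    and Z: "Z = block_row (U ** Cp) W"
    and F: "F = block_row (Ap + Bp ** K ** Cp) (Bp ** V)"
    and G: "G = block_row (K ** Cp) V"
    and M\<^sub>\<Lambda>: "M\<^sub>\<Lambda> = - (2 *\<^sub>R (transpose Z ** D0 ** \<Lambda> ** D1 ** Z))
                + He (transpose H ** \<Lambda> ** (D0 + D1) ** Z)
                - 2 *\<^sub>R (transpose H ** \<Lambda> ** H)"
    and Q: "0 \<preceq>\<^sub>L Q" and R: "0 \<preceq>\<^sub>L R"
    and \<beta>: "0 < \<beta>" "\<beta> \<le> 1"
    and nonexpansive: "componentwise_nonexpansive \<phi>"
    and sector: "static_sector \<phi> D0 D1"
    and pf: "spectral_radius (abs_matrix W) < 1"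
    and P: "pos_def P"
    and \<Lambda>: "diag_matrix \<Lambda>" "0 \<preceq>\<^sub>L \<Lambda>"
    and lmi: "\<beta> *\<^sub>R (transpose F ** P ** F) - transpose X ** P ** X
                + transpose X ** Q ** X + transpose G ** R ** G + M\<^sub>\<Lambda> \<preceq>\<^sub>L 0"
  shows
    "(\<forall>y. \<exists>!\<eta>. \<eta> = \<phi> (W *v \<eta> + U *v y)) \<and>
     (\<forall>x y \<eta> u. closed_loop Ap Bp Cp K V W U \<phi> x y \<eta> u \<longrightarrow>
        summable (discounted_stage_cost \<beta> Q R x u) \<and>
        discounted_cost \<beta> Q R x u \<le> x 0 \<bullet> (P *v x 0)) \<and>
     (\<forall>(M :: 'w measure) x0 x y \<eta> u.
        prob_space M \<and> x0 \<in> borel_measurable M \<and>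
        (\<forall>\<omega>\<in>space M. x \<omega> 0 = x0 \<omega> \<and>
           closed_loop Ap Bp Cp K V W U \<phi> (x \<omega>) (y \<omega>) (\<eta> \<omega>) (u \<omega>)) \<longrightarrow>
        (integrable M (\<lambda>\<omega>. outer_prod (x0 \<omega>)) \<longrightarrow>
           integrable M (\<lambda>\<omega>. discounted_cost \<beta> Q R (x \<omega>) (u \<omega>)) \<and>
           prob_space.expectation M (\<lambda>\<omega>. discounted_cost \<beta> Q R (x \<omega>) (u \<omega>))
             \<le> trace (P ** second_moment M x0)) \<and>
        (integrable M x0 \<and> integrable M (\<lambda>\<omega>. outer_prod (x0 \<omega> - mean M x0)) \<longrightarrow>
           integrable M (\<lambda>\<omega>. discounted_cost \<beta> Q R (x \<omega>) (u \<omega>)) \<and>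
           prob_space.expectation M (\<lambda>\<omega>. discounted_cost \<beta> Q R (x \<omega>) (u \<omega>))
             \<le> trace (P ** covariance M x0) + mean M x0 \<bullet> (P *v mean M x0) \<and>
           trace (P ** second_moment M x0)
             = trace (P ** covariance M x0) + mean M x0 \<bullet> (P *v mean M x0)))"
proof -
  have exu: "\<exists>!r. r = \<phi> (W *v r + b)" for b
    by (rule implicit_equation_unique_solution[OF nonexpansive pf])
  define h where "h b = (THE r. r = \<phi> (W *v r + b))" for b
  have h_sol: "h b = \<phi> (W *v h b + b)" for b
    unfolding h_def by (rule theI'[OF exu])
  have h_unique: "r = h b" if "r = \<phi> (W *v r + b)" for r b
    using exu[of b] that h_sol by blast
  have h_cont: "continuous_on UNIV h"
    by (rule implicit_equation_solution_continuous[OF nonexpansive pf h_sol])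
  have Q_nonneg: "0 \<le> z \<bullet> (Q *v z)" for z
    using Q by (simp add: loewner_le_def)
  have R_nonneg: "0 \<le> z \<bullet> (R *v z)" for z
    using R by (simp add: loewner_le_def)
  have P_nonneg: "0 \<le> z \<bullet> (P *v z)" for z
    using P by (cases "z = 0") (auto simp: pos_def_def less_imp_le)

  have det: "summable (discounted_stage_cost \<beta> Q R x u)"
      "discounted_cost \<beta> Q R x u \<le> x 0 \<bullet> (P *v x 0)"
    if loop: "closed_loop Ap Bp Cp K V W U \<phi> x y \<eta> u" for x y \<eta> u
  proof -
    define c where "c k = x k \<bullet> (Q *v x k) + u k \<bullet> (R *v u k)" for k
    have "\<beta> * (x (Suc k) \<bullet> (P *v x (Suc k))) + c k \<le> x k \<bullet> (P *v x k)" for k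
    proof -
      \<comment> \<open>The stacked vector at which the matrix inequality is evaluated; the block
        rows send it to the signals of the loop.\<close>
      define v where "v = (\<chi> j. case j of Inl i \<Rightarrow> x k $ i | Inr i \<Rightarrow> \<eta> k $ i)"
      have loop_k: "x (Suc k) = Ap *v x k + Bp *v u k" "y k = Cp *v x k"
        "\<eta> k = \<phi> (W *v \<eta> k + U *v y k)" "u k = K *v y k + V *v \<eta> k"
        using loop unfolding closed_loop_def by blast+
      have Xv: "X *v v = x k" and Hv: "H *v v = \<eta> k"
        unfolding X H v_def block_row_mult_vector by simp_all
      have Gv: "G *v v = u k"
        unfolding G v_def block_row_mult_vector
        by (simp only: loop_k(2,4) matrix_vector_mul_assoc)
      have Fv: "F *v v = x (Suc k)"
        unfolding F v_def block_row_mult_vector loop_k(1,2,4)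
        by (simp only: matrix_vector_mul_assoc[symmetric] matrix_vector_mult_add_rdistrib
            matrix_vector_right_distrib add.assoc)
      have Zv: "Z *v v = W *v \<eta> k + U *v y k"
        unfolding Z v_def block_row_mult_vector
        by (simp only: loop_k(2) matrix_vector_mul_assoc add.commute)
      have "H *v v = \<phi> (Z *v v)"
        unfolding Hv Zv by (rule loop_k(3))
      then have "0 \<le> v \<bullet> (M\<^sub>\<Lambda> *v v)"
        by (rule sector_multiplier_nonneg[OF sector \<Lambda> M\<^sub>\<Lambda>])
      moreover have "v \<bullet> ((\<beta> *\<^sub>R (transpose F ** P ** F) - transpose X ** P ** X
          + transpose X ** Q ** X + transpose G ** R ** G + M\<^sub>\<Lambda>) *v v) \<le> 0"
        using lmi by (simp only: loewner_le_def matrix_vector_mult_0 inner_zero_right)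
      ultimately show ?thesis
        by (simp only: matrix_vector_mult_add_rdistrib matrix_vector_mult_diff_rdistrib
            inner_add_right inner_diff_right scaleR_matrix_vector inner_scaleR_right
            inner_congruence Xv Fv Gv c_def)
    qed
    note * = discounted_sum_le_storage[where V = "\<lambda>k. x k \<bullet> (P *v x k)" and c = c, OF \<beta>(1) P_nonneg _ this]
    have "0 \<le> c k" for k
      unfolding c_def by (intro add_nonneg_nonneg Q_nonneg R_nonneg)
    note * = *[OF this]
    show "summable (discounted_stage_cost \<beta> Q R x u)"
      "discounted_cost \<beta> Q R x u \<le> x 0 \<bullet> (P *v x 0)"
      using * by (simp_all add: discounted_cost_def discounted_stage_cost_def[abs_def] c_def)
  qed

  have expected: "integrable M (\<lambda>\<omega>. discounted_cost \<beta> Q R (x \<omega>) (u \<omega>))"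
      "(\<integral>\<omega>. discounted_cost \<beta> Q R (x \<omega>) (u \<omega>) \<partial>M) \<le> trace (P ** second_moment M x0)"
    if x0: "x0 \<in> borel_measurable M"
      and loop: "\<forall>\<omega>\<in>space M. x \<omega> 0 = x0 \<omega> \<and>
        closed_loop Ap Bp Cp K V W U \<phi> (x \<omega>) (y \<omega>) (\<eta> \<omega>) (u \<omega>)"
      and moment: "integrable M (\<lambda>\<omega>. outer_prod (x0 \<omega>))"
    for M :: "'w measure" and x0 x y \<eta> u
  proof -
    have init: "(\<lambda>\<omega>. x \<omega> 0) \<in> borel_measurable M"
      using x0 loop measurable_cong[of M "\<lambda>\<omega>. x \<omega> 0" x0 borel] by blast
    have "closed_loop Ap Bp Cp K V W U \<phi> (x \<omega>) (y \<omega>) (\<eta> \<omega>) (u \<omega>)"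
      if "\<omega> \<in> space M" for \<omega>
      using loop that by blast
    note xu = closed_loop_measurable[where \<phi> = \<phi> and W = W and h = h and x = x,
        OF h_unique h_cont init this]
    have meas: "(\<lambda>\<omega>. discounted_cost \<beta> Q R (x \<omega>) (u \<omega>)) \<in> borel_measurable M"
      by (rule discounted_cost_measurable[where x = x and u = u, OF xu])
    \<comment> \<open>Integrability by domination compares norms, so the lower bound accompanies the
      upper one.\<close>
    have bounds: "0 \<le> discounted_cost \<beta> Q R (x \<omega>) (u \<omega>)"
      "discounted_cost \<beta> Q R (x \<omega>) (u \<omega>) \<le> x0 \<omega> \<bullet> (P *v x0 \<omega>)" if "\<omega> \<in> space M" for \<omega>
    proof -
      have l: "closed_loop Ap Bp Cp K V W U \<phi> (x \<omega>) (y \<omega>) (\<eta> \<omega>) (u \<omega>)" and "x \<omega> 0 = x0 \<omega>"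
        using loop that by auto
      then show "discounted_cost \<beta> Q R (x \<omega>) (u \<omega>) \<le> x0 \<omega> \<bullet> (P *v x0 \<omega>)"
        using det(2)[OF l] by simp
      show "0 \<le> discounted_cost \<beta> Q R (x \<omega>) (u \<omega>)"
        unfolding discounted_cost_def
        by (rule suminf_nonneg[OF det(1)[OF l]])
          (simp add: discounted_stage_cost_def Q_nonneg R_nonneg less_imp_le[OF \<beta>(1)])
    qed
    note quad = quadratic_form_moment[OF moment, of P]
    show int: "integrable M (\<lambda>\<omega>. discounted_cost \<beta> Q R (x \<omega>) (u \<omega>))"
      by (rule Bochner_Integration.integrable_bound[OF quad(1) meas])
        (use bounds in \<open>auto intro!: AE_I2 simp: P_nonneg\<close>)
    show "(\<integral>\<omega>. discounted_cost \<beta> Q R (x \<omega>) (u \<omega>) \<partial>M) \<le> trace (P ** second_moment M x0)"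
      unfolding quad(2)[symmetric] by (rule integral_mono[OF int quad(1) bounds(2)])
  qed

  have trace_eq: "trace (P ** second_moment M x0)
      = trace (P ** covariance M x0) + mean M x0 \<bullet> (P *v mean M x0)"
    if "prob_space M" "integrable M x0" "integrable M (\<lambda>\<omega>. outer_prod (x0 \<omega> - mean M x0))"
    for M :: "'w measure" and x0 :: "'w \<Rightarrow> real^'n"
    by (simp add: second_moment_eq_covariance(2)[OF that] matrix_add_ldistrib trace_add
        quadratic_form_eq_trace)

  show ?thesis
  proof (intro conjI allI impI, goal_cases)
    case (1 y)
    show ?case by (rule exu)
  next
    case (2 x y \<eta> u)
    then show ?case by (rule det(1))
  next
    case (3 x y \<eta> u)
    then show ?case by (rule det(2))
  next
    case (4 M x0 x y \<eta> u)
    then show ?case using expected(1) by blast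
  next
    case (5 M x0 x y \<eta> u)
    then show ?case using expected(2) by blast
  next
    case (6 M x0 x y \<eta> u)
    \<comment> \<open>Integrability of the state and of its centered outer product reduces this case
      to the second-moment case.\<close>
    then have "integrable M (\<lambda>\<omega>. outer_prod (x0 \<omega>))"
      using second_moment_eq_covariance(1) by blast
    with 6 show ?case using expected(1) by blast
  next
    case (7 M x0 x y \<eta> u)
    then have "integrable M (\<lambda>\<omega>. outer_prod (x0 \<omega>))"
      using second_moment_eq_covariance(1) by blast
    with 7 have "(\<integral>\<omega>. discounted_cost \<beta> Q R (x \<omega>) (u \<omega>) \<partial>M) \<le> trace (P ** second_moment M x0)"
      using expected(2) by blast
    also have "trace (P ** second_moment M x0)
        = trace (P ** covariance M x0) + mean M x0 \<bullet> (P *v mean M x0)"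
      using 7 by (intro trace_eq) blast+
    finally show ?case .
  next
    case (8 M x0 x y \<eta> u)
    then show ?case using trace_eq by blast
  qed
qed

end
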